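(* Let $F$ be a free filter on $\omega$. If $N_F$ has the bounded Josefson--Nissenzweig property (BJNP), then $F$ is meager and of measure zero.
   Context: A filter $F$ on $\omega$ is free if $\bigcap F=\emptyset$ (equivalently, $F$ contains every cofinite set); filters are proper. Filters are viewed as subsets of the Cantor space $2^\omega$ via characteristic functions; "meager" refers to the usual topology of $2^\omega$ and "measure zero" to the standard product probability measure on $2^\omega$. For a free filter $F$ on $\omega$, $N_F=\omega\cup\{p_F\}$, $p_F\notin\omega$, with the topology in which every point of $\omega$ is isolated and the open neighborhoods of $p_F$ are exactly the sets $A\cup\{p_F\}$ with $A\in F$. A finitely supported measure on a Tychonoff space $X$ is $\mu=\sum_{i=1}^n\alpha_i\delta_{x_i}$ with distinct $x_i\in X$ and $\alpha_i\in\mathbb{R}\setminus\{0\}$; $\|\mu\|=\sum_i|\alpha_i|$, $\mu(f)=\sum_i\alpha_i f(x_i)$. $X$ has the BJNP if there is a sequence $\langle\mu_n: n\in\omega\rangle$ of finitely supported measures on $X$ with $\|\mu_n\|=1$ for all $n$ and $\mu_n(f)\to0$ for every bounded continuous $f:X\to\mathbb{R}$. *)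

theory Defs
  imports "HOL-Probability.Probability"
begin

section \<open>Free filters and the Cantor space\<close>

text \<open>
  Filters on the natural numbers are elements of the library type \<^typ>\<open>nat filter\<close>. That type also
  contains the improper filter \<^term>\<open>bot\<close> (which contains the empty set), so properness
  is part of freeness.
\<close>

definition filter_sets :: "'a filter \<Rightarrow> 'a set set"
  where "filter_sets F = {A. \<forall>\<^sub>F n in F. n \<in> A}"

definition free_filter :: "'a filter \<Rightarrow> bool"
  where "free_filter F \<longleftrightarrow> F \<noteq> bot \<and> \<Inter>(filter_sets F) = {}"

definition filter_in_cantor :: "nat filter \<Rightarrow> (nat \<Rightarrow> bool) set"
  where "filter_in_cantor F = (\<lambda>A n. n \<in> A) ` filter_sets F"

definition cantor_space :: "(nat \<Rightarrow> bool) topology"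
  where "cantor_space = product_topology (\<lambda>_. discrete_topology UNIV) UNIV"

definition cantor_measure :: "(nat \<Rightarrow> bool) measure"
  where "cantor_measure = PiM UNIV (\<lambda>_. measure_pmf (bernoulli_pmf (1/2)))"

text \<open>
  The completion is used because the set in question need not be measurable with respect to the
  product sigma-algebra: measure zero means being contained in a measurable null set.
\<close>

definition cantor_measure_zero :: "(nat \<Rightarrow> bool) set \<Rightarrow> bool"
  where "cantor_measure_zero S \<longleftrightarrow> S \<in> null_sets (completion cantor_measure)"

definition nowhere_dense_in :: "'a topology \<Rightarrow> 'a set \<Rightarrow> bool"
  where "nowhere_dense_in X S \<longleftrightarrow> S \<subseteq> topspace X \<and> X interior_of (X closure_of S) = {}"

definition meager_in :: "'a topology \<Rightarrow> 'a set \<Rightarrow> bool"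
  where "meager_in X S \<longleftrightarrow>
    (\<exists>\<C>. countable \<C> \<and> (\<forall>T\<in>\<C>. nowhere_dense_in X T) \<and> S = \<Union>\<C>)"

section \<open>The space of a filter\<close>

text \<open>
  The number \<open>n\<close> is represented by \<^term>\<open>Some n\<close>, the extra point by \<^term>\<open>None\<close>.
\<close>

definition N_space :: "nat filter \<Rightarrow> nat option topology"
  where "N_space F = topology (\<lambda>U. None \<in> U \<longrightarrow> {n. Some n \<in> U} \<in> filter_sets F)"

lemma openin_N_space:
  "openin (N_space F) U \<longleftrightarrow> (None \<in> U \<longrightarrow> {n. Some n \<in> U} \<in> filter_sets F)"
proof -
  have "istopology (\<lambda>U. None \<in> U \<longrightarrow> {n. Some n \<in> U} \<in> filter_sets F)"
    unfolding istopology_def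
  proof (intro conjI allI impI)
    fix S T :: "nat option set"
    assume "None \<in> S \<longrightarrow> {n. Some n \<in> S} \<in> filter_sets F"
      and "None \<in> T \<longrightarrow> {n. Some n \<in> T} \<in> filter_sets F" and "None \<in> S \<inter> T"
    then show "{n. Some n \<in> S \<inter> T} \<in> filter_sets F"
      by (simp add: filter_sets_def eventually_conj_iff)
  next
    fix \<K> :: "nat option set set"
    assume \<K>: "\<forall>K\<in>\<K>. None \<in> K \<longrightarrow> {n. Some n \<in> K} \<in> filter_sets F" and "None \<in> \<Union>\<K>"
    then obtain K where "K \<in> \<K>" "None \<in> K"
      by blast
    then have "\<forall>\<^sub>F n in F. Some n \<in> K"
      using \<K> by (simp add: filter_sets_def)
    then have "\<forall>\<^sub>F n in F. Some n \<in> \<Union>\<K>"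
      by (rule eventually_mono) (use \<open>K \<in> \<K>\<close> in blast)
    then show "{n. Some n \<in> \<Union>\<K>} \<in> filter_sets F"
      by (simp add: filter_sets_def)
  qed
  then show ?thesis
    by (simp add: N_space_def)
qed

lemma topspace_N_space: "topspace (N_space F) = UNIV"
proof -
  have "openin (N_space F) UNIV"
    by (simp add: openin_N_space filter_sets_def)
  then show ?thesis
    using openin_subset by blast
qed

lemma openin_N_space_isolated: "openin (N_space F) {Some n}"
  by (simp add: openin_N_space)

lemma openin_N_space_None:
  "openin (N_space F) U \<and> None \<in> U \<longleftrightarrow> (\<exists>A\<in>filter_sets F. U = insert None (Some ` A))"
proof
  assume U: "openin (N_space F) U \<and> None \<in> U"
  have "U = insert None (Some ` {n. Some n \<in> U})"
  proof (rule set_eqI)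
    fix x show "x \<in> U \<longleftrightarrow> x \<in> insert None (Some ` {n. Some n \<in> U})"
      using U by (cases x) auto
  qed
  moreover have "{n. Some n \<in> U} \<in> filter_sets F"
    using U by (simp add: openin_N_space)
  ultimately show "\<exists>A\<in>filter_sets F. U = insert None (Some ` A)"
    by (rule rev_bexI[rotated])
qed (auto simp: openin_N_space image_iff)

section \<open>The bounded Josefson--Nissenzweig property\<close>

text \<open>
  A finitely supported measure is represented by its weight function, which maps each support
  point to its nonzero coefficient and every other point to 0.
\<close>

definition fs_supp :: "('a \<Rightarrow> real) \<Rightarrow> 'a set"
  where "fs_supp \<mu> = {x. \<mu> x \<noteq> 0}"

definition fs_measure_on :: "'a topology \<Rightarrow> ('a \<Rightarrow> real) \<Rightarrow> bool"
  where "fs_measure_on X \<mu> \<longleftrightarrow> finite (fs_supp \<mu>) \<and> fs_supp \<mu> \<subseteq> topspace X"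

definition fs_norm :: "('a \<Rightarrow> real) \<Rightarrow> real"
  where "fs_norm \<mu> = (\<Sum>x\<in>fs_supp \<mu>. \<bar>\<mu> x\<bar>)"

definition fs_integral :: "('a \<Rightarrow> real) \<Rightarrow> ('a \<Rightarrow> real) \<Rightarrow> real"
  where "fs_integral \<mu> f = (\<Sum>x\<in>fs_supp \<mu>. \<mu> x * f x)"

definition BJNP :: "'a topology \<Rightarrow> bool"
  where "BJNP X \<longleftrightarrow>
    (\<exists>\<mu> :: nat \<Rightarrow> 'a \<Rightarrow> real.
      (\<forall>n. fs_measure_on X (\<mu> n) \<and> fs_norm (\<mu> n) = 1) \<and>
      (\<forall>f. continuous_map X euclideanreal f \<and> bounded (f ` topspace X) \<longrightarrow>
        (\<lambda>n. fs_integral (\<mu> n) f) \<longlonglongrightarrow> 0))"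

end

theory Submission
  imports Defs
begin

text \<open>
  Let \<open>\<mu>\<^sub>n\<close> witness the BJNP of \<open>N\<^sub>F\<close>. For \<open>A \<in> F\<close>, every bounded function vanishing on \<open>A\<close> and at the
  extra point is continuous, so the measures \<open>\<mu>\<^sub>n\<close> restricted to the complement of \<open>A\<close> are weakly
  null in \<open>\<ell>\<^sub>1\<close>, and by Schur's theorem (a gliding hump) \<open>|\<mu>\<^sub>n|\<close> of this complement tends to 0. Testing
  with the constant 1 shows that at least about half of the mass of \<open>\<mu>\<^sub>n\<close> lies on the natural
  numbers. A second gliding hump then gives probability weights \<open>w\<^sub>k\<close> on consecutive disjoint
  intervals \<open>S\<^sub>k\<close> such that every \<open>A \<in> F\<close> satisfies \<open>w\<^sub>k(S\<^sub>k - A) \<le> 1/4\<close> for almost all \<open>k\<close>.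

  In particular \<open>A\<close> meets almost all \<open>S\<^sub>k\<close>, which is Talagrand's criterion for meagerness. For the
  measure, replace membership by Rademacher signs: the averages \<open>Y\<^sub>k\<close> of the signs with respect to \<open>w\<^sub>k\<close>
  are orthogonal and bounded by 1, so the mean of \<open>N\<close> of them has second moment at most \<open>1/N\<close>,
  whereas on \<open>F\<close> almost all \<open>Y\<^sub>k\<close> are at least \<open>1/2\<close>.
\<close>

section \<open>Gliding humps in a matrix with columns tending to zero\<close>

text \<open>Rows and cut points are chosen alternately: a cut past the support of the current row,
  then a later row whose sum before that cut is small. For nonnegative \<open>a\<close>, row
  \<open>r k\<close> thus lives on the block from \<open>M k\<close> to \<open>M (Suc k)\<close> up
  to \<open>\<delta>\<close>. In both applications \<open>Q\<close> is a lower bound on the total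
  mass of a row.\<close>

lemma gliding_hump:
  fixes a :: "nat \<Rightarrow> nat \<Rightarrow> real"
  assumes supp: "\<And>n i. K n \<le> i \<Longrightarrow> a n i = 0"
    and lim: "\<And>i. (\<lambda>n. a n i) \<longlonglongrightarrow> 0"
    and freq: "\<exists>\<^sub>F n in sequentially. Q n" and "\<delta> > 0"
  obtains r M where "strict_mono r" "strict_mono M" "\<And>k. Q (r k)"
    "\<And>k. (\<Sum>i<M k. a (r k) i) < \<delta>" "\<And>k i. M (Suc k) \<le> i \<Longrightarrow> a (r k) i = 0"
proof -
  \<comment> \<open>A pair consists of a row index and the cut in front of the hump of that
    row.\<close>
  define P where "P p \<longleftrightarrow> Q (fst p) \<and> (\<Sum>i<snd p. a (fst p) i) < \<delta>" for p :: "nat \<times> nat"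
  have "\<exists>f. \<forall>k. P (f k) \<and> (fst (f k) < fst (f (Suc k)) \<and> snd (f k) < snd (f (Suc k))
      \<and> K (fst (f k)) \<le> snd (f (Suc k)))"
  proof (rule dependent_nat_choice)
    obtain n where "Q n"
      using freq by (auto simp: frequently_sequentially)
    \<comment> \<open>With cut 0 the head is an empty sum, so any row with \<open>Q\<close> can
      start.\<close>
    then have "P (n, 0)"
      using \<open>\<delta> > 0\<close> by (simp add: P_def)
    then show "\<exists>p. P p" ..
  next
    fix p assume "P p"
    \<comment> \<open>\<open>Suc\<close> makes the cuts strictly increasing. The cut is fixed before
      the next row is sought, so only finitely many columns have to be small.\<close>
    define m where "m = max (Suc (snd p)) (K (fst p))"
    have "(\<lambda>n. \<Sum>i<m. a n i) \<longlonglongrightarrow> 0"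
      by (rule tendsto_null_sum) (rule lim)
    then have "\<forall>\<^sub>F n in sequentially. (\<Sum>i<m. a n i) < \<delta>"
      using \<open>\<delta> > 0\<close> by (rule order_tendstoD)
    then have "\<forall>\<^sub>F n in sequentially. (\<Sum>i<m. a n i) < \<delta> \<and> fst p < n"
      using eventually_gt_at_top by (rule eventually_conj)
    with freq obtain n where "Q n" "(\<Sum>i<m. a n i) < \<delta>" "fst p < n"
      by (auto simp: frequently_sequentially eventually_sequentially)
    then have "P (n, m) \<and> (fst p < fst (n, m) \<and> snd p < snd (n, m) \<and> K (fst p) \<le> snd (n, m))"
      by (simp add: P_def m_def)
    then show "\<exists>q. P q \<and> (fst p < fst q \<and> snd p < snd q \<and> K (fst p) \<le> snd q)" ..
  qed
  then obtain f where f: "\<And>k. P (f k)" "\<And>k. fst (f k) < fst (f (Suc k))"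
    "\<And>k. snd (f k) < snd (f (Suc k))" "\<And>k. K (fst (f k)) \<le> snd (f (Suc k))"
    by blast
  show thesis
  proof (rule that)
    show "strict_mono (\<lambda>k. fst (f k))" "strict_mono (\<lambda>k. snd (f k))"
      using f by (simp_all add: strict_mono_Suc_iff)
    show "Q (fst (f k))" "(\<Sum>i<snd (f k). a (fst (f k)) i) < \<delta>" for k
      using f(1)[of k] by (simp_all add: P_def)
    show "a (fst (f k)) i = 0" if "snd (f (Suc k)) \<le> i" for k i
      using that f(4)[of k] by (intro supp) simp
  qed
qed

section \<open>Continuous functions and finitely supported measures on
  \<open>N_space F\<close>\<close>

text \<open>When \<open>f\<close> takes its value at the extra point on a whole set of the filter,
  the preimage of every set is open, so continuity only leaves the condition on the range.\<close>

lemma continuous_map_N_space: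
  assumes "\<forall>\<^sub>F n in F. f (Some n) = f None"
  shows "continuous_map (N_space F) X f \<longleftrightarrow> range f \<subseteq> topspace X"
proof -
  have "openin (N_space F) {x. f x \<in> U}" for U
  proof -
    have "\<forall>\<^sub>F n in F. f (Some n) \<in> U" if "f None \<in> U"
      using assms that by (auto elim: eventually_mono)
    then show ?thesis
      by (simp add: openin_N_space filter_sets_def)
  qed
  then show ?thesis
    by (auto simp: continuous_map_def topspace_N_space Pi_iff)
qed

lemma fs_sum_option:
  fixes g :: "nat option \<Rightarrow> real"
  assumes "\<And>x. \<mu> x = 0 \<Longrightarrow> g x = 0" and "\<And>i. K \<le> i \<Longrightarrow> \<mu> (Some i) = 0"
  shows "(\<Sum>x\<in>fs_supp \<mu>. g x) = g None + (\<Sum>i<K. g (Some i))"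
proof -
  have "fs_supp \<mu> \<subseteq> insert None (Some ` {..<K})"
  proof
    fix x assume "x \<in> fs_supp \<mu>"
    then show "x \<in> insert None (Some ` {..<K})"
      using assms(2)[of "the x"] by (cases x) (auto simp: fs_supp_def intro: leI)
  qed
  then have "(\<Sum>x\<in>fs_supp \<mu>. g x) = (\<Sum>x\<in>insert None (Some ` {..<K}). g x)"
    by (intro sum.mono_neutral_left) (auto simp: fs_supp_def assms(1))
  also have "\<dots> = g None + (\<Sum>i<K. g (Some i))"
    by (simp add: sum.reindex)
  finally show ?thesis .
qed

lemma free_filter_eventually_neq:
  assumes "free_filter F"
  shows "\<forall>\<^sub>F n in F. n \<noteq> i"
proof -
  obtain A where "A \<in> filter_sets F" "i \<notin> A"
    using assms by (auto simp: free_filter_def)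
  then show ?thesis
    by (auto simp: filter_sets_def elim: eventually_mono)
qed

lemma fs_supp_option_bound:
  fixes \<mu> :: "nat option \<Rightarrow> real"
  assumes "finite (fs_supp \<mu>)"
  shows "\<exists>K. \<forall>i\<ge>K. \<mu> (Some i) = 0"
proof -
  have "finite (Some -` fs_supp \<mu>)"
    using assms by (rule finite_vimageI) simp
  then obtain K where "\<forall>i\<in>Some -` fs_supp \<mu>. i < K"
    using finite_nat_set_iff_bounded by blast
  then show ?thesis
    by (auto simp: fs_supp_def not_le[symmetric])
qed

section \<open>Weakly null sequences of measures and Schur's argument\<close>

text \<open>The BJNP in working form: \<open>K n\<close> bounds the support of
  \<open>\<mu> n\<close> among the numbers, so that integrals become sums over initial segments, and
  the test functions are those equal to their value at the extra point along
  \<open>F\<close>.\<close>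

locale JN_sequence =
  fixes F :: "nat filter" and \<mu> :: "nat \<Rightarrow> nat option \<Rightarrow> real" and K :: "nat \<Rightarrow> nat"
  assumes free: "free_filter F"
    and supp: "\<And>n i. K n \<le> i \<Longrightarrow> \<mu> n (Some i) = 0"
    and norm: "\<And>n. \<bar>\<mu> n None\<bar> + (\<Sum>i<K n. \<bar>\<mu> n (Some i)\<bar>) = 1"
    and null: "\<And>f. bounded (range f) \<Longrightarrow> \<forall>\<^sub>F i in F. f (Some i) = f None \<Longrightarrow>
      (\<lambda>n. \<mu> n None * f None + (\<Sum>i<K n. \<mu> n (Some i) * f (Some i))) \<longlonglongrightarrow> 0"
begin

lemma sum_ge:
  assumes "\<And>i. \<mu> n (Some i) = 0 \<Longrightarrow> g i = (0 :: real)" and "K n \<le> L"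
  shows "(\<Sum>i<L. g i) = (\<Sum>i<K n. g i)"
  using assms supp by (intro sum.mono_neutral_right) (auto simp: not_less)

text \<open>The test function is the indicator of a single number; it is admissible because freeness
  provides a set of \<open>F\<close> avoiding that number.\<close>

lemma coeff_tendsto_0: "(\<lambda>n. \<mu> n (Some i)) \<longlonglongrightarrow> 0"
proof -
  define f :: "nat option \<Rightarrow> real" where "f x = (if x = Some i then 1 else 0)" for x
  have "\<forall>\<^sub>F n in F. f (Some n) = f None"
    using free_filter_eventually_neq[OF free, of i] by (auto simp: f_def elim: eventually_mono)
  moreover have "bounded (range f)"
    by (rule finite_imp_bounded, rule finite_subset[of _ "{0,1}"]) (auto simp: f_def)
  ultimately have "(\<lambda>n. \<mu> n None * f None + (\<Sum>j<K n. \<mu> n (Some j) * f (Some j))) \<longlonglongrightarrow> 0"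
    by (intro null)
  moreover have "\<mu> n None * f None + (\<Sum>j<K n. \<mu> n (Some j) * f (Some j)) = \<mu> n (Some i)" for n
    using supp[of n i] by (simp add: f_def if_distrib[of "\<lambda>x. _ * x"] sum.delta not_less cong: if_cong)
  ultimately show ?thesis
    by simp
qed

text \<open>Otherwise infinitely many rows have mass at least \<open>\<epsilon>\<close> off
  \<open>A\<close>. On their humps one function \<open>f\<close>, zero on \<open>A\<close> and at
  the extra point, can copy the signs of all chosen rows at once, and then each of these rows
  integrates \<open>f\<close> to at least \<open>\<epsilon> / 2\<close>.\<close>

lemma mass_outside_tendsto_0:
  assumes A: "\<forall>\<^sub>F i in F. i \<in> A"
  shows "(\<lambda>n. \<Sum>i<K n. if i \<in> A then 0 else \<bar>\<mu> n (Some i)\<bar>) \<longlonglongrightarrow> 0"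
proof (rule ccontr)
  define a where "a n i = (if i \<in> A then 0 else \<bar>\<mu> n (Some i)\<bar>)" for n i
  have a0: "0 \<le> a n i" for n i
    by (simp add: a_def)
  have aK: "a n i = 0" if "K n \<le> i" for n i
    using supp[OF that] by (simp add: a_def)
  assume "\<not> (\<lambda>n. \<Sum>i<K n. if i \<in> A then 0 else \<bar>\<mu> n (Some i)\<bar>) \<longlonglongrightarrow> 0"
  then have "\<not> (\<lambda>n. \<Sum>i<K n. a n i) \<longlonglongrightarrow> 0"
    by (simp add: a_def)
  then obtain \<epsilon> where "\<epsilon> > 0" "\<not> (\<forall>\<^sub>F n in sequentially. dist (\<Sum>i<K n. a n i) 0 < \<epsilon>)"
    by (auto simp: tendsto_iff)
  then have freq: "\<exists>\<^sub>F n in sequentially. \<epsilon> \<le> (\<Sum>i<K n. a n i)"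
    by (simp add: not_eventually not_less sum_nonneg a0)
  obtain r M where r: "strict_mono r" and M: "strict_mono M"
    and Q: "\<And>k. \<epsilon> \<le> (\<Sum>i<K (r k). a (r k) i)"
    and small: "\<And>k. (\<Sum>i<M k. a (r k) i) < \<epsilon> / 4"
    and zero: "\<And>k i. M (Suc k) \<le> i \<Longrightarrow> a (r k) i = 0"
  proof (rule gliding_hump[where a = a and K = K and \<delta> = "\<epsilon> / 4"])
    show "(\<lambda>n. a n i) \<longlonglongrightarrow> 0" for i
      using tendsto_rabs_zero[OF coeff_tendsto_0[of i]] by (cases "i \<in> A") (simp_all add: a_def)
  qed (use aK freq \<open>\<epsilon> > 0\<close> in auto)
  \<comment> \<open>The index of the block containing \<open>i\<close>. Numbers below
    \<open>M 0\<close> get the default 0; this is harmless, as they belong to the head of every row,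
    where only \<open>\<bar>f\<bar> \<le> 1\<close> matters.\<close>
  define \<kappa> where "\<kappa> i = (LEAST k. i < M (Suc k))" for i
  define f where "f x = (case x of None \<Rightarrow> 0 | Some i \<Rightarrow>
    if i \<in> A then 0 else sgn (\<mu> (r (\<kappa> i)) (Some i)))" for x
  have \<kappa>: "\<kappa> i = k" if "M k \<le> i" "i < M (Suc k)" for i k
    unfolding \<kappa>_def
  proof (rule Least_equality)
    show "k \<le> l" if "i < M (Suc l)" for l
      using \<open>M k \<le> i\<close> that strict_mono_less[OF M, of k "Suc l"] by simp
  qed (rule that)
  have f_le: "\<bar>f x\<bar> \<le> 1" for x
    by (auto simp: f_def sgn_if split: option.split)
  have "(\<lambda>n. \<mu> n None * f None + (\<Sum>i<K n. \<mu> n (Some i) * f (Some i))) \<longlonglongrightarrow> 0"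
  proof (rule null)
    show "bounded (range f)"
      using f_le by (auto simp: bounded_iff)
    show "\<forall>\<^sub>F i in F. f (Some i) = f None"
      using A by (rule eventually_mono) (simp add: f_def)
  qed
  then have "(\<lambda>k. \<mu> (r k) None * f None + (\<Sum>i<K (r k). \<mu> (r k) (Some i) * f (Some i))) \<longlonglongrightarrow> 0"
    using LIMSEQ_subseq_LIMSEQ[OF _ r] by (auto simp: comp_def)
  then have "\<forall>\<^sub>F k in sequentially. \<mu> (r k) None * f None + (\<Sum>i<K (r k). \<mu> (r k) (Some i) * f (Some i)) < \<epsilon> / 2"
    using \<open>\<epsilon> > 0\<close> by (intro order_tendstoD) auto
  then obtain k where k: "(\<Sum>i<K (r k). \<mu> (r k) (Some i) * f (Some i)) < \<epsilon> / 2"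
    by (auto simp: f_def eventually_sequentially)
  \<comment> \<open>The cut \<open>M k\<close> may exceed \<open>K (r k)\<close>; a common range
    contains both the head and the support.\<close>
  define L where "L = max (M k) (K (r k))"
  \<comment> \<open>The head counts twice: its mass is missing from the hump, and \<open>f\<close>
    may have the opposite sign there. Hence the choice of \<open>\<epsilon> / 4\<close> for the
    head.\<close>
  have "\<epsilon> / 2 \<le> (\<Sum>i<L. a (r k) i) - 2 * (\<Sum>i<M k. a (r k) i)"
  proof -
    have "(\<Sum>i<L. a (r k) i) = (\<Sum>i<K (r k). a (r k) i)"
      by (rule sum_ge) (auto simp: a_def L_def)
    then show ?thesis
      using Q[of k] small[of k] by linarith
  qed
  also have "(\<Sum>i<M k. a (r k) i) = (\<Sum>i<L. if i < M k then a (r k) i else 0)"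
    by (rule sum.mono_neutral_cong_left) (auto simp: L_def)
  also have "(\<Sum>i<L. a (r k) i) - 2 * (\<Sum>i<L. if i < M k then a (r k) i else 0)
      = (\<Sum>i<L. a (r k) i - 2 * (if i < M k then a (r k) i else 0))"
    by (simp add: sum_subtractf sum_distrib_left)
  also have "\<dots> \<le> (\<Sum>i<L. \<mu> (r k) (Some i) * f (Some i))"
  proof (rule sum_mono)
    fix i
    \<comment> \<open>Head: the product is at least \<open>- a\<close>. Hump: it equals
      \<open>a\<close>. Tail: both sides vanish.\<close>
    consider "i < M k" | "M k \<le> i" "i < M (Suc k)" | "M k \<le> i" "M (Suc k) \<le> i"
      by linarith
    then show "a (r k) i - 2 * (if i < M k then a (r k) i else 0) \<le> \<mu> (r k) (Some i) * f (Some i)"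
    proof cases
      case 1
      have "- \<bar>\<mu> (r k) (Some i)\<bar> * 1 \<le> - \<bar>\<mu> (r k) (Some i)\<bar> * \<bar>f (Some i)\<bar>"
        using f_le[of "Some i"] by (intro mult_left_mono_neg) auto
      also have "\<dots> \<le> \<mu> (r k) (Some i) * f (Some i)"
        by (simp add: abs_mult[symmetric])
      finally show ?thesis
        using 1 by (auto simp: a_def f_def)
    next
      case 2
      then show ?thesis
        by (auto simp: a_def f_def \<kappa> abs_sgn)
    next
      case 3
      then show ?thesis
        using zero[of k i] by (auto simp: a_def f_def split: if_splits)
    qed
  qed
  also have "\<dots> = (\<Sum>i<K (r k). \<mu> (r k) (Some i) * f (Some i))"
    by (rule sum_ge) (auto simp: L_def)
  finally show False
    using k by simp
qed

text \<open>By the constant function 1, the extra point eventually carries less than the mass on the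
  numbers plus 1/3. The two add up to 1, so twice the mass on the numbers exceeds 2/3.\<close>

lemma eventually_mass_ge: "\<forall>\<^sub>F n in sequentially. 1 / 3 \<le> (\<Sum>i<K n. \<bar>\<mu> n (Some i)\<bar>)"
proof -
  have "(\<lambda>n. \<mu> n None * 1 + (\<Sum>i<K n. \<mu> n (Some i) * 1)) \<longlonglongrightarrow> 0"
    by (rule null) auto
  then have "\<forall>\<^sub>F n in sequentially. \<mu> n None * 1 + (\<Sum>i<K n. \<mu> n (Some i) * 1) < 1 / 3"
      "\<forall>\<^sub>F n in sequentially. - 1 / 3 < \<mu> n None * 1 + (\<Sum>i<K n. \<mu> n (Some i) * 1)"
    by (rule order_tendstoD, simp)+
  then show ?thesis
  proof eventually_elim
    case (elim n)
    have "\<bar>\<Sum>i<K n. \<mu> n (Some i)\<bar> \<le> (\<Sum>i<K n. \<bar>\<mu> n (Some i)\<bar>)"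
      by (rule sum_abs)
    then show ?case
      using elim norm[of n] by (simp add: abs_le_iff) linarith
  qed
qed

text \<open>The weights are the humps of \<open>\<bar>\<mu> n\<bar>\<close>, normalised on their
  blocks. The bound 1/4 is what later keeps the sign averages at least 1 - 2/4 = 1/2.\<close>

lemma block_weights:
  "\<exists>(M :: nat \<Rightarrow> nat) (w :: nat \<Rightarrow> nat \<Rightarrow> real). strict_mono M \<and> (\<forall>k i. 0 \<le> w k i) \<and>
    (\<forall>k. (\<Sum>i\<in>{M k..<M (Suc k)}. w k i) = 1) \<and>
    (\<forall>A. (\<forall>\<^sub>F i in F. i \<in> A) \<longrightarrow>
      (\<forall>\<^sub>F k in sequentially. (\<Sum>i\<in>{M k..<M (Suc k)}. if i \<in> A then 0 else w k i) \<le> 1 / 4))"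
proof -
  define a where "a n i = \<bar>\<mu> n (Some i)\<bar>" for n i
  have freq: "\<exists>\<^sub>F n in sequentially. 1 / 3 \<le> (\<Sum>i<K n. a n i)"
    using eventually_mass_ge by (auto simp: a_def intro: eventually_frequently)
  obtain r M where r: "strict_mono r" and M: "strict_mono M"
    and Q: "\<And>k. 1 / 3 \<le> (\<Sum>i<K (r k). a (r k) i)"
    and small: "\<And>k. (\<Sum>i<M k. a (r k) i) < 1 / 12"
    and zero: "\<And>k i. M (Suc k) \<le> i \<Longrightarrow> a (r k) i = 0"
  proof (rule gliding_hump[where a = a and K = K and \<delta> = "1 / 12"])
    show "(\<lambda>n. a n i) \<longlonglongrightarrow> 0" for i
      using tendsto_rabs_zero[OF coeff_tendsto_0[of i]] by (simp add: a_def)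
  qed (use freq supp in \<open>auto simp: a_def\<close>)
  define J where "J k = {M k..<M (Suc k)}" for k
  define c where "c k = (\<Sum>i\<in>J k. a (r k) i)" for k
  have a0: "0 \<le> a n i" for n i
    by (simp add: a_def)
  \<comment> \<open>Total mass 1/3 minus a head below 1/12; nothing lies beyond the block.\<close>
  have c: "1 / 4 \<le> c k" for k
  proof -
    define L where "L = max (M (Suc k)) (K (r k))"
    have "1 / 3 \<le> (\<Sum>i<K (r k). a (r k) i)"
      by (rule Q)
    also have "\<dots> = (\<Sum>i<L. a (r k) i)"
      by (rule sum_ge[symmetric]) (auto simp: a_def L_def)
    also have "\<dots> = (\<Sum>i<M (Suc k). a (r k) i)"
      using zero[of k] by (intro sum.mono_neutral_right) (auto simp: L_def not_less)
    also have "\<dots> = (\<Sum>i<M k. a (r k) i) + c k"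
      unfolding c_def J_def using strict_mono_less[OF M, of k "Suc k"]
      by (subst sum.union_disjoint[symmetric]) (auto intro!: sum.cong)
    finally show ?thesis
      using small[of k] by simp
  qed
  have c_pos: "0 < c k" for k
    using c[of k] by linarith
  define w where "w k i = a (r k) i / c k" for k i
  show ?thesis
  proof (intro exI conjI allI impI)
    show "0 \<le> w k i" for k i
      using a0 c_pos[of k] by (simp add: w_def less_imp_le)
    show "(\<Sum>i\<in>{M k..<M (Suc k)}. w k i) = 1" for k
      using c_pos[of k] by (simp add: w_def sum_divide_distrib[symmetric] c_def J_def[symmetric])
    fix A assume "\<forall>\<^sub>F i in F. i \<in> A"
    from mass_outside_tendsto_0[OF this]
    have "(\<lambda>k. \<Sum>i<K (r k). if i \<in> A then 0 else a (r k) i) \<longlonglongrightarrow> 0"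
      unfolding a_def using LIMSEQ_subseq_LIMSEQ[OF _ r] by (auto simp: comp_def)
    \<comment> \<open>Normalisation divides by \<open>c k\<close>, which is at least 1/4, so 1/16
      turns into 1/4.\<close>
    then have "\<forall>\<^sub>F k in sequentially. (\<Sum>i<K (r k). if i \<in> A then 0 else a (r k) i) < 1 / 16"
      by (rule order_tendstoD) simp
    then show "\<forall>\<^sub>F k in sequentially. (\<Sum>i\<in>{M k..<M (Suc k)}. if i \<in> A then 0 else w k i) \<le> 1 / 4"
    proof eventually_elim
      case (elim k)
      define b where "b i = (if i \<in> A then 0 else a (r k) i)" for i
      define L where "L = max (M (Suc k)) (K (r k))"
      have "(\<Sum>i\<in>J k. b i) \<le> (\<Sum>i<L. b i)"
        by (rule sum_mono2) (auto simp: J_def b_def L_def a0)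
      also have "\<dots> = (\<Sum>i<K (r k). b i)"
        by (rule sum_ge) (auto simp: L_def b_def a_def)
      finally have b: "(\<Sum>i\<in>J k. b i) \<le> 1 / 16"
        using elim by (simp add: b_def)
      have "(\<Sum>i\<in>J k. if i \<in> A then 0 else w k i) = (\<Sum>i\<in>J k. b i) / c k"
        by (auto simp: sum_divide_distrib b_def w_def intro!: sum.cong)
      also have "\<dots> \<le> (1 / 16) / (1 / 4)"
        using b c[of k] by (intro frac_le) auto
      finally show ?case
        by (simp add: J_def)
    qed
  qed (rule M)
qed

end

text \<open>Finite supports yield the bounds \<open>K\<close>, and the test functions of the locale
  are continuous by \<open>continuous_map_N_space\<close>.\<close>

lemma BJNP_N_space_imp_JN_sequence:
  assumes "free_filter F" "BJNP (N_space F)"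
  obtains \<mu> K where "JN_sequence F \<mu> K"
proof -
  obtain \<mu> :: "nat \<Rightarrow> nat option \<Rightarrow> real"
    where \<mu>: "\<And>n. fs_measure_on (N_space F) (\<mu> n)" "\<And>n. fs_norm (\<mu> n) = 1"
      and lim: "\<And>f. continuous_map (N_space F) euclideanreal f \<Longrightarrow> bounded (range f) \<Longrightarrow>
        (\<lambda>n. fs_integral (\<mu> n) f) \<longlonglongrightarrow> 0"
    using assms(2) by (auto simp: BJNP_def topspace_N_space)
  have "\<exists>K. \<forall>i\<ge>K. \<mu> n (Some i) = 0" for n
    using \<mu>(1)[of n] by (intro fs_supp_option_bound) (simp add: fs_measure_on_def)
  then obtain K where K: "\<And>n i. K n \<le> i \<Longrightarrow> \<mu> n (Some i) = 0"
    by metis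
  have "JN_sequence F \<mu> K"
  proof
    show "\<bar>\<mu> n None\<bar> + (\<Sum>i<K n. \<bar>\<mu> n (Some i)\<bar>) = 1" for n
      using \<mu>(2)[of n] K by (simp add: fs_norm_def fs_sum_option[where K = "K n"])
    show "(\<lambda>n. \<mu> n None * f None + (\<Sum>i<K n. \<mu> n (Some i) * f (Some i))) \<longlonglongrightarrow> 0"
      if "bounded (range f)" "\<forall>\<^sub>F i in F. f (Some i) = f None" for f
    proof -
      have "fs_integral (\<mu> n) f = \<mu> n None * f None + (\<Sum>i<K n. \<mu> n (Some i) * f (Some i))" for n
        unfolding fs_integral_def using K by (intro fs_sum_option) auto
      then show ?thesis
        using lim[of f] that by (simp add: continuous_map_N_space)
    qed
  qed (use assms K in auto)
  then show thesis ..
qed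

section \<open>Meagerness in the Cantor space\<close>

text \<open>Missing a finite block is an open condition, so the set is closed. Its interior is empty
  because a basic open set restricts finitely many coordinates, while some block lies entirely
  beyond them and can be erased.\<close>

lemma nowhere_dense_in_hitting_sets:
  fixes S :: "nat \<Rightarrow> nat set"
  assumes fin: "\<And>k. finite (S k)" and tail: "\<And>k. S k \<subseteq> {k..}"
  shows "nowhere_dense_in cantor_space {x. \<forall>k\<ge>m. \<exists>i\<in>S k. x i}"
    (is "nowhere_dense_in _ ?T")
proof -
  have "closedin cantor_space ?T"
  proof -
    have "openin cantor_space {x. \<not> x i}" for i
    proof -
      have "continuous_map cantor_space (discrete_topology UNIV) (\<lambda>x. x i)"
        unfolding cantor_space_def by (rule continuous_map_product_projection) simp
      from openin_continuous_map_preimage[OF this, of "{False}"]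
      show ?thesis
        by (simp add: cantor_space_def)
    qed
    then have "openin cantor_space (topspace cantor_space \<inter> (\<Inter>i\<in>S k. {x. \<not> x i}))" for k
      by (intro openin_Int_Inter) (auto simp: fin)
    then have "openin cantor_space (\<Union>k\<in>{m..}. topspace cantor_space \<inter> (\<Inter>i\<in>S k. {x. \<not> x i}))"
      by blast
    also have "(\<Union>k\<in>{m..}. topspace cantor_space \<inter> (\<Inter>i\<in>S k. {x. \<not> x i})) = topspace cantor_space - ?T"
      by (auto simp: cantor_space_def)
    finally show ?thesis
      by (simp add: closedin_def cantor_space_def)
  qed
  moreover have "cantor_space interior_of ?T = {}"
  proof (rule ccontr)
    assume "cantor_space interior_of ?T \<noteq> {}"
    then obtain x U where U: "openin cantor_space U" "U \<subseteq> ?T" "x \<in> U"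
      by (auto simp: interior_of_def)
    then obtain V where V: "finite {i. V i \<noteq> (UNIV :: bool set)}" "x \<in> Pi\<^sub>E UNIV V" "Pi\<^sub>E UNIV V \<subseteq> U"
      by (auto simp: cantor_space_def openin_product_topology_alt)
    obtain n where n: "\<And>i. V i \<noteq> UNIV \<Longrightarrow> i < n"
      using V(1) finite_nat_set_iff_bounded by auto
    \<comment> \<open>At least \<open>m\<close>, so that block \<open>k\<close> must be hit; at
      least \<open>n\<close>, so that it avoids all restricted coordinates.\<close>
    define k where "k = max m n"
    define y where "y i = (i \<notin> S k \<and> x i)" for i
    have "y i \<in> V i" for i
    proof (cases "V i = UNIV")
      case False
      then have "i \<notin> S k"
        using n[of i] tail[of k] by (auto simp: k_def)
      then show ?thesis
        using V(2) by (auto simp: y_def PiE_iff)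
    qed simp
    then have "y \<in> ?T"
      using V(3) U(2) by (auto simp: PiE_iff subset_iff)
    then have "\<exists>i\<in>S k. y i"
      by (simp add: k_def)
    then show False
      by (simp add: y_def)
  qed
  ultimately show ?thesis
    by (simp add: nowhere_dense_in_def closure_of_closedin closedin_subset)
qed

text \<open>\<open>meager_in\<close> asks for an exact union, so the covering sets are intersected
  with \<open>A\<close>; nowhere density passes to subsets.\<close>

lemma meager_in_subset_UN:
  assumes "A \<subseteq> (\<Union>m::nat. T m)" and "\<And>m. nowhere_dense_in X (T m)"
  shows "meager_in X A"
  unfolding meager_in_def
proof (intro exI conjI ballI)
  show "countable (range (\<lambda>m. A \<inter> T m))" "A = \<Union>(range (\<lambda>m. A \<inter> T m))"
    using assms(1) by auto
  fix S assume "S \<in> range (\<lambda>m. A \<inter> T m)"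
  then obtain m where S: "S = A \<inter> T m"
    by blast
  have "X interior_of (X closure_of S) \<subseteq> X interior_of (X closure_of T m)"
    unfolding S by (intro interior_of_mono closure_of_mono) simp
  then show "nowhere_dense_in X S"
    using assms(2)[of m] by (auto simp: nowhere_dense_in_def S)
qed

section \<open>Rademacher signs and null sets for the coin-tossing measure\<close>

interpretation cantor: prob_space cantor_measure
  unfolding cantor_measure_def by (intro prob_space_PiM prob_space_measure_pmf)

lemma space_cantor_measure [simp]: "space cantor_measure = UNIV"
  by (simp add: cantor_measure_def space_PiM)

lemma measurable_cantor_coordinate [measurable]: "Measurable.pred cantor_measure (\<lambda>x. x i)"
proof -
  have "(\<lambda>x. x i) \<in> cantor_measure \<rightarrow>\<^sub>M measure_pmf (bernoulli_pmf (1/2))"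
    unfolding cantor_measure_def by (rule measurable_component_singleton) simp
  then show ?thesis
    by (simp add: measurable_def)
qed

definition rademacher :: "nat \<Rightarrow> (nat \<Rightarrow> bool) \<Rightarrow> real"
  where "rademacher i x = (if x i then 1 else - 1)"

lemma measurable_rademacher [measurable]: "rademacher i \<in> borel_measurable cantor_measure"
  unfolding rademacher_def by measurable

lemma integrable_cantor_bounded:
  fixes f :: "(nat \<Rightarrow> bool) \<Rightarrow> real"
  assumes "f \<in> borel_measurable cantor_measure" "\<And>x. \<bar>f x\<bar> \<le> B"
  shows "integrable cantor_measure f"
  using assms by (intro cantor.integrable_const_bound[of _ B]) auto

text \<open>The product is 1 where the two coordinates agree and -1 elsewhere, and by independence
  they agree with probability 1/4 + 1/4.\<close>

lemma rademacher_orthogonal: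
  assumes "i \<noteq> j"
  shows "(\<integral>x. rademacher i x * rademacher j x \<partial>cantor_measure) = 0"
proof -
  have *: "cantor.prob {x. x i = b \<and> x j = b} = 1 / 4" for b
  proof -
    interpret product_prob_space "\<lambda>_. measure_pmf (bernoulli_pmf (1/2))" "UNIV :: nat set"
      by unfold_locales
    have "emeasure cantor_measure {x. x i = b \<and> x j = b} =
        (\<Prod>l\<in>{i, j}. emeasure (measure_pmf (bernoulli_pmf (1/2))) {b})"
      using emeasure_PiM_Collect[of "{i, j}" "\<lambda>_. {b}"]
      by (simp add: cantor_measure_def space_PiM)
    also have "\<dots> = ennreal (1 / 2) * ennreal (1 / 2)"
      using assms by (cases b) (simp_all add: emeasure_pmf_single)
    also have "\<dots> = ennreal (1 / 4)"
      by (subst ennreal_mult[symmetric]) simp_all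
    finally show ?thesis
      by (simp add: measure_def)
  qed
  have meas: "{x. x i \<and> x j} \<in> cantor.events" "{x. \<not> x i \<and> \<not> x j} \<in> cantor.events"
    using predE[of "\<lambda>x. x i \<and> x j" cantor_measure] predE[of "\<lambda>x. \<not> x i \<and> \<not> x j" cantor_measure]
    by simp_all
  have "cantor.prob {x. x i = x j} = cantor.prob ({x. x i = True \<and> x j = True} \<union> {x. x i = False \<and> x j = False})"
    by (rule arg_cong[where f = cantor.prob]) auto
  also have "\<dots> = 1 / 4 + 1 / 4"
    using meas *[of True] *[of False] by (subst cantor.finite_measure_Union) auto
  finally have eq: "cantor.prob {x. x i = x j} = 1 / 2"
    by simp
  have int: "integrable cantor_measure (indicat_real {x. x i = x j})"
  proof -
    have "{x \<in> space cantor_measure. x i = x j} \<in> cantor.events"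
      by measurable
    then show ?thesis
      by (intro integrable_cantor_bounded[of _ 1]) (auto simp: indicator_def)
  qed
  have "(\<integral>x. rademacher i x * rademacher j x \<partial>cantor_measure) =
      (\<integral>x. 2 * indicator {x. x i = x j} x - 1 \<partial>cantor_measure)"
    by (rule Bochner_Integration.integral_cong) (auto simp: rademacher_def indicator_def)
  also have "\<dots> = 0"
    by (subst Bochner_Integration.integral_diff)
      (auto simp: eq int cantor.prob_space[simplified])
  finally show ?thesis .
qed

text \<open>A second-moment estimate: disjoint blocks make the averages orthogonal, so a sum of
  \<open>N\<close> of them has second moment at most \<open>N\<close>. On the given set this sum is
  at least \<open>N / 2\<close>, which bounds the probability by \<open>4 / N\<close> for every
  positive \<open>N\<close>.\<close>

lemma null_sets_large_block_averages:
  fixes S :: "nat \<Rightarrow> nat set" and w :: "nat \<Rightarrow> nat \<Rightarrow> real"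
  assumes fin: "\<And>k. finite (S k)" and disj: "\<And>k l. k \<noteq> l \<Longrightarrow> S k \<inter> S l = {}"
    and w0: "\<And>k i. 0 \<le> w k i" and w1: "\<And>k. (\<Sum>i\<in>S k. w k i) = 1"
  shows "{x. \<forall>k\<ge>m. 1 / 2 \<le> (\<Sum>i\<in>S k. w k i * rademacher i x)} \<in> null_sets cantor_measure"
    (is "?G \<in> _")
proof -
  define Y where "Y k x = (\<Sum>i\<in>S k. w k i * rademacher i x)" for k x
  have Y_meas [measurable]: "Y k \<in> borel_measurable cantor_measure" for k
    unfolding Y_def by measurable
  have Y_le: "\<bar>Y k x\<bar> \<le> 1" for k x
  proof -
    have "\<bar>Y k x\<bar> \<le> (\<Sum>i\<in>S k. \<bar>w k i * rademacher i x\<bar>)"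
      unfolding Y_def by (rule sum_abs)
    also have "\<dots> = (\<Sum>i\<in>S k. w k i)"
      by (rule sum.cong) (auto simp: rademacher_def w0)
    finally show ?thesis
      by (simp add: w1)
  qed
  have int_YY: "integrable cantor_measure (\<lambda>x. Y k x * Y l x)" for k l
    using Y_le by (intro integrable_cantor_bounded[of _ 1]) (auto simp: abs_mult intro: mult_le_one)
  have orth: "(\<integral>x. Y k x * Y l x \<partial>cantor_measure) = 0" if "k \<noteq> l" for k l
  proof -
    have int: "integrable cantor_measure (\<lambda>x. w k i * w l j * (rademacher i x * rademacher j x))" for i j
      by (intro integrable_mult_right integrable_cantor_bounded[of _ 1]) (auto simp: rademacher_def)
    have "(\<integral>x. Y k x * Y l x \<partial>cantor_measure) =
        (\<integral>x. (\<Sum>i\<in>S k. \<Sum>j\<in>S l. w k i * w l j * (rademacher i x * rademacher j x)) \<partial>cantor_measure)"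
      by (simp add: Y_def sum_product mult_ac)
    also have "\<dots> = (\<Sum>i\<in>S k. \<Sum>j\<in>S l. w k i * w l j * (\<integral>x. rademacher i x * rademacher j x \<partial>cantor_measure))"
      using int by (simp add: Bochner_Integration.integral_sum)
    also have "\<dots> = 0"
    proof (intro sum.neutral ballI)
      fix i j assume "i \<in> S k" "j \<in> S l"
      then have "i \<noteq> j"
        using disj[OF that] by blast
      then show "w k i * w l j * (\<integral>x. rademacher i x * rademacher j x \<partial>cantor_measure) = 0"
        by (simp add: rademacher_orthogonal)
    qed
    finally show ?thesis .
  qed
  have sq_le: "(\<integral>x. Y k x * Y k x \<partial>cantor_measure) \<le> 1" for k
  proof (rule cantor.integral_le_const[OF int_YY])
    show "AE x in cantor_measure. Y k x * Y k x \<le> 1"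
      using Y_le[of k] by (simp add: power2_eq_square[symmetric] abs_square_le_1)
  qed
  have G_meas [measurable]: "?G \<in> sets cantor_measure"
  proof -
    have "{x\<in>space cantor_measure. \<forall>k\<ge>m. 1 / 2 \<le> Y k x} \<in> sets cantor_measure"
      by measurable
    then show ?thesis
      by (simp add: Y_def)
  qed
  have G_le: "cantor.prob ?G \<le> 4 / real N" if "N > 0" for N
  proof -
    \<comment> \<open>The sum starts at \<open>m\<close>, since membership in the set controls only
      the averages from \<open>m\<close> on.\<close>
    define Z where "Z x = (\<Sum>k\<in>{m..<m + N}. Y k x)" for x
    have Z_meas [measurable]: "Z \<in> borel_measurable cantor_measure"
      unfolding Z_def by measurable
    have Z2: "(Z x)\<^sup>2 = (\<Sum>k\<in>{m..<m + N}. \<Sum>l\<in>{m..<m + N}. Y k x * Y l x)" for x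
      by (simp add: Z_def power2_eq_square sum_product)
    have int: "integrable cantor_measure (\<lambda>x. (Z x)\<^sup>2)"
      unfolding Z2 using int_YY by auto
    have "(\<integral>x. (Z x)\<^sup>2 \<partial>cantor_measure) =
        (\<Sum>k\<in>{m..<m + N}. \<Sum>l\<in>{m..<m + N}. \<integral>x. Y k x * Y l x \<partial>cantor_measure)"
      unfolding Z2 using int_YY by (simp add: Bochner_Integration.integral_sum)
    also have "\<dots> = (\<Sum>k\<in>{m..<m + N}. \<integral>x. Y k x * Y k x \<partial>cantor_measure)"
    proof (rule sum.cong)
      fix k assume "k \<in> {m..<m + N}"
      then have "(\<Sum>l\<in>{m..<m + N}. \<integral>x. Y k x * Y l x \<partial>cantor_measure) =
          (\<Sum>l\<in>{k}. \<integral>x. Y k x * Y l x \<partial>cantor_measure)"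
        by (intro sum.mono_neutral_right) (auto simp: orth)
      then show "(\<Sum>l\<in>{m..<m + N}. \<integral>x. Y k x * Y l x \<partial>cantor_measure) =
          (\<integral>x. Y k x * Y k x \<partial>cantor_measure)"
        by simp
    qed simp
    also have "\<dots> \<le> real N"
      using sum_mono[of "{m..<m + N}" _ "\<lambda>_. 1", OF sq_le] by simp
    finally have Z2_le: "(\<integral>x. (Z x)\<^sup>2 \<partial>cantor_measure) \<le> real N" .
    have "cantor.prob ?G \<le> cantor.prob {x\<in>space cantor_measure. real N / 2 \<le> \<bar>Z x\<bar>}"
    proof (rule cantor.finite_measure_mono)
      show "?G \<subseteq> {x\<in>space cantor_measure. real N / 2 \<le> \<bar>Z x\<bar>}"
      proof
        fix x assume "x \<in> ?G"
        then have "(\<Sum>k\<in>{m..<m + N}. 1 / 2) \<le> Z x"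
          unfolding Z_def by (intro sum_mono) (auto simp: Y_def)
        then show "x \<in> {x\<in>space cantor_measure. real N / 2 \<le> \<bar>Z x\<bar>}"
          by simp
      qed
    qed measurable
    \<comment> \<open>Chebyshev's inequality in its uncentred form.\<close>
    also have "\<dots> \<le> (\<integral>x. (Z x)\<^sup>2 \<partial>cantor_measure) / (real N / 2)\<^sup>2"
      using \<open>N > 0\<close> int by (intro cantor.second_moment_method) auto
    also have "\<dots> \<le> real N / (real N / 2)\<^sup>2"
      using Z2_le by (rule divide_right_mono) simp
    also have "\<dots> = 4 / real N"
      using \<open>N > 0\<close> by (simp add: power2_eq_square field_simps)
    finally show ?thesis .
  qed
  have "(\<lambda>N. 4 / real N) \<longlonglongrightarrow> 0"
    by (rule lim_const_over_n)
  then have "cantor.prob ?G \<le> 0"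
    by (rule LIMSEQ_le_const) (use G_le in \<open>auto intro!: exI[of _ 1]\<close>)
  then have "cantor.prob ?G = 0"
    by (simp add: order_antisym)
  then show ?thesis
    using G_meas by (simp add: null_sets_def cantor.emeasure_eq_measure)
qed

section \<open>Covering the filter by countably many small sets\<close>

theorem corollary6p6:
  fixes F :: "nat filter"
  assumes "free_filter F"
    and "BJNP (N_space F)"
  shows "meager_in cantor_space (filter_in_cantor F) \<and> cantor_measure_zero (filter_in_cantor F)"
proof -
  obtain \<mu> K where "JN_sequence F \<mu> K"
    using assms by (rule BJNP_N_space_imp_JN_sequence)
  then interpret JN_sequence F \<mu> K .
  obtain M and w :: "nat \<Rightarrow> nat \<Rightarrow> real" where M: "strict_mono M" and w0: "\<And>k i. 0 \<le> w k i"
    and w1: "\<And>k. (\<Sum>i\<in>{M k..<M (Suc k)}. w k i) = 1"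
    and conc: "\<And>A. \<forall>\<^sub>F i in F. i \<in> A \<Longrightarrow>
      \<forall>\<^sub>F k in sequentially. (\<Sum>i\<in>{M k..<M (Suc k)}. if i \<in> A then 0 else w k i) \<le> 1 / 4"
    using block_weights by blast
  define S where "S k = {M k..<M (Suc k)}" for k
  have fin: "finite (S k)" for k
    by (simp add: S_def)
  have tail: "S k \<subseteq> {k..}" for k
    using strict_mono_imp_increasing[OF M, of k] by (auto simp: S_def)
  have disj: "S k \<inter> S l = {}" if "k \<noteq> l" for k l
  proof -
    have "M (Suc k) \<le> M l \<or> M (Suc l) \<le> M k"
      using that by (auto simp: strict_mono_less_eq[OF M])
    then show ?thesis
      by (auto simp: S_def)
  qed
  define T where "T m = {x. \<forall>k\<ge>m. \<exists>i\<in>S k. x i}" for m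
  define G where "G m = {x. \<forall>k\<ge>m. 1 / 2 \<le> (\<Sum>i\<in>S k. w k i * rademacher i x)}" for m
  have "\<exists>m. x \<in> T m \<and> x \<in> G m" if "x \<in> filter_in_cantor F" for x
  proof -
    have "\<forall>\<^sub>F i in F. i \<in> {i. x i}"
      using that by (auto simp: filter_in_cantor_def filter_sets_def)
    from conc[OF this] obtain m where
      m: "\<And>k. m \<le> k \<Longrightarrow> (\<Sum>i\<in>S k. if x i then 0 else w k i) \<le> 1 / 4"
      by (auto simp: eventually_sequentially S_def)
    \<comment> \<open>A block missed by \<open>x\<close> would have its whole weight 1 outside,
      against the bound 1/4.\<close>
    have "\<exists>i\<in>S k. x i" if "m \<le> k" for k
    proof (rule ccontr)
      assume "\<not> (\<exists>i\<in>S k. x i)"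
      then have "(\<Sum>i\<in>S k. if x i then 0 else w k i) = (\<Sum>i\<in>S k. w k i)"
        by (intro sum.cong) auto
      then show False
        using m[OF that] w1[of k] by (simp add: S_def)
    qed
    moreover have "1 / 2 \<le> (\<Sum>i\<in>S k. w k i * rademacher i x)" if "m \<le> k" for k
    proof -
      \<comment> \<open>Each missing point turns its contribution from \<open>w k i\<close> to
        \<open>- w k i\<close>, so the missing weight is subtracted twice from 1.\<close>
      have "(\<Sum>i\<in>S k. w k i * rademacher i x) = (\<Sum>i\<in>S k. w k i - 2 * (if x i then 0 else w k i))"
        by (rule sum.cong) (auto simp: rademacher_def)
      also have "\<dots> = 1 - 2 * (\<Sum>i\<in>S k. if x i then 0 else w k i)"
        unfolding sum_subtractf sum_distrib_left[symmetric] using w1[of k] by (simp add: S_def)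
      finally show ?thesis
        using m[OF that] by simp
    qed
    ultimately show ?thesis
      by (auto simp: T_def G_def)
  qed
  then have sub: "filter_in_cantor F \<subseteq> (\<Union>m. T m)" "filter_in_cantor F \<subseteq> (\<Union>m. G m)"
    by blast+
  have "meager_in cantor_space (filter_in_cantor F)"
    using sub(1) by (rule meager_in_subset_UN)
      (simp add: T_def nowhere_dense_in_hitting_sets[OF fin tail])
  moreover have "(\<Union>m. G m) \<in> null_sets cantor_measure"
    unfolding G_def
    by (intro null_sets_UN null_sets_large_block_averages fin disj w0) (simp_all add: S_def w1)
  \<comment> \<open>The filter itself may be nonmeasurable; in the completion every subset of a null
    set is null.\<close>
  then have "cantor_measure_zero (filter_in_cantor F)"
    unfolding cantor_measure_zero_def
    by (rule null_sets_completion_subset[OF sub(2) null_sets_completionI])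
  ultimately show ?thesis ..
qed

end
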